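(* Fix positive integers $n,m\ge2$ and, for $i=1,\ldots,n$, let $\{\mu_{ij}\}_{j=1}^m$ be a sequence of reals such that $1>\mu_{i1}\ge\cdots\ge\mu_{im}>0$ and for which the class $\mathcal{B}(\mu_{i1},\ldots,\mu_{im})$ is non-empty. Let $X_1,\ldots,X_n$ be independent random variables such that $X_i\in\mathcal{B}(\mu_{i1},\ldots,\mu_{im})$ for $i=1,\ldots,n$, and fix $t\in[0,n]$. Then $$\mathbb{P}\left[\sum_{i=1}^nX_i\ge t\right]\le\inf_{f\in\mathcal{F}_{ic}(t)}\frac{1}{f(t)}\mathbb{E}[f(Z_{nm})],$$ where $Z_{nm}=\sum_{i=1}^nZ_i$ is a sum of independent random variables $Z_i$ such that $$\mathbb{P}[Z_i=j/m]=\binom mj\cdot\mathbb{E}\left[X_i^j(1-X_i)^{m-j}\right],\quad j=0,1,\ldots,m.$$ Moreover, $$\inf_{f\in\mathcal{F}_{ic}(t)}\frac{1}{f(t)}\mathbb{E}[f(Z_{nm})]=\inf_{a<t}\frac{1}{t-a}\mathbb{E}[\max\{0,Z_{nm}-a\}].$$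
   Context: For $\mu_1,\ldots,\mu_m\in(0,1)$, $\mathcal{B}(\mu_1,\ldots,\mu_m)$ is the class of all random variables $X$ with $0\le X\le1$ and $\mathbb{E}[X^j]=\mu_j$ for $j=1,\ldots,m$. $\mathcal{F}_{ic}(t)$ is the set of all convex functions $f:[0,\infty)\to[0,\infty)$ that are increasing (in the sense of nondecreasing) on $[t,\infty)$; infima over $\mathcal{F}_{ic}(t)$ are over those $f$ with $f(t)>0$. The infimum over $a<t$ is over real numbers $a$. *)

theory Defs
  imports "HOL-Probability.Probability"
begin

text \<open>
  The random variables on the probability space \<open>M\<close> that belong to the class
  \<open>\<B>(\<mu>\<^sub>1, \<dots>, \<mu>\<^sub>m)\<close>.  As usual in probability, the bounds are required almost surely;
  only the values \<open>\<mu> j\<close> with \<open>1 \<le> j \<le> m\<close> matter.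
\<close>

definition moment_class :: "'a measure \<Rightarrow> nat \<Rightarrow> (nat \<Rightarrow> real) \<Rightarrow> ('a \<Rightarrow> real) set" where
  "moment_class M m \<mu> =
     {X \<in> borel_measurable M.
        (AE \<omega> in M. 0 \<le> X \<omega> \<and> X \<omega> \<le> 1) \<and>
        (\<forall>j\<in>{1..m}. integral\<^sup>L M (\<lambda>\<omega>. X \<omega> ^ j) = \<mu> j)}"

text \<open>
  The class \<open>\<F>\<^sub>i\<^sub>c(t)\<close> of functions \<open>[0,\<infinity>) \<rightarrow> [0,\<infinity>)\<close>.  Extensionality matters: were \<open>f\<close> free on
  the negative reals, \<open>f \<circ> Z\<close> could fail to be measurable because of values of \<open>Z\<close> on a
  null set, and its Bochner integral would then be 0 by convention.
\<close>

definition F_ic :: "real \<Rightarrow> (real \<Rightarrow> real) set" where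
  "F_ic t = {f \<in> {0..} \<rightarrow>\<^sub>E {0..}. convex_on {0..} f \<and> mono_on {t..} f}"

end

theory Submission
  imports Defs
begin

text \<open>
  The first claim is Markov's inequality combined with one application of Jensen's inequality.
  For fixed numbers \<open>x\<^sub>i \<in> [0,1]\<close>, the products \<open>\<Prod>\<^sub>i Bernstein m (j\<^sub>i) (x\<^sub>i)\<close> are the probabilities of
  the grid points \<open>(j\<^sub>1/m, \<dots>, j\<^sub>n/m)\<close> under independent
  binomial laws, rescaled by \<open>1/m\<close> so that their means are the \<open>x\<^sub>i\<close>.
  A convex \<open>f\<close> therefore satisfies
  \<open>f (\<Sum>\<^sub>i x\<^sub>i) \<le> \<Sum>\<^sub>j (\<Prod>\<^sub>i Bernstein m (j\<^sub>i) (x\<^sub>i)) f (\<Sum>\<^sub>i j\<^sub>i/m)\<close>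
  (\<open>convex_le_tensor_Bernstein\<close>).  Substituting \<open>x\<^sub>i = X\<^sub>i\<close> and taking expectations,
  independence lets the expectation pass inside the product, where \<open>E (Bernstein m j X\<^sub>i)\<close> is by
  hypothesis the probability that \<open>Z\<^sub>i = j/m\<close>; since the \<open>Z\<^sub>i\<close> are independent too and live on the
  grid, the right-hand side becomes \<open>E (f (\<Sum>\<^sub>i Z\<^sub>i))\<close> (\<open>expectation_sum_of_grid_variables\<close>).

  For the second claim, each hinge function \<open>x \<mapsto> max 0 (x - a)\<close> with \<open>a < t\<close> is itself a competitor,
  so the infimum over the class is at most the infimum over hinges.  Conversely, a competitor
  \<open>f\<close> lies above a supporting line at \<open>t\<close> of slope \<open>c \<ge> 0\<close> (\<open>supporting_line_nonneg_slope\<close>).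
  If \<open>c > 0\<close>, the line vanishes at \<open>a = t - f t / c\<close> and, as \<open>f \<ge> 0\<close>, the function \<open>f / f t\<close> dominates
  the hinge at \<open>a\<close>, normalised to be \<open>1\<close> at \<open>t\<close>.  If \<open>c = 0\<close>, then \<open>f / f t \<ge> 1\<close>, and \<open>1\<close> is the
  limit of the normalised hinge expectations as \<open>a\<close> tends to \<open>-\<infinity>\<close>.
\<close>

section \<open>Tensor products of Bernstein polynomials\<close>

lemma sum_tensor_Bernstein:
  assumes "finite I"
  shows "(\<Sum>j\<in>I \<rightarrow>\<^sub>E {..m}. \<Prod>i\<in>I. Bernstein m (j i) (x i)) = 1"
  using assms by (subst prod_sum_PiE [symmetric]) auto

text \<open>
  The barycentre of the tensor weights.  Inserting a factor that differs from \<open>1\<close> only at the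
  index \<open>k\<close> keeps the product form, so that each marginal mean can be computed separately.
\<close>
lemma sum_tensor_Bernstein_mean:
  assumes I: "finite I" and m: "m > 0"
  shows "(\<Sum>j\<in>I \<rightarrow>\<^sub>E {..m}. (\<Prod>i\<in>I. Bernstein m (j i) (x i)) * (\<Sum>i\<in>I. real (j i) / real m))
           = (\<Sum>i\<in>I. x i)"
proof -
  have marginal: "(\<Sum>j\<in>I \<rightarrow>\<^sub>E {..m}. (\<Prod>i\<in>I. Bernstein m (j i) (x i)) * (real (j k) / real m)) = x k"
    if k: "k \<in> I" for k
  proof -
    have mean: "(\<Sum>l\<le>m. Bernstein m l y * (real l / real m)) = y" for y
    proof -
      have "(\<Sum>l\<le>m. Bernstein m l y * (real l / real m)) = (\<Sum>l\<le>m. real l * Bernstein m l y) / real m"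
        unfolding sum_divide_distrib by (intro sum.cong) auto
      also have "\<dots> = y"
        unfolding sum_k_Bernstein using m by simp
      finally show ?thesis .
    qed
    have "(\<Sum>j\<in>I \<rightarrow>\<^sub>E {..m}. (\<Prod>i\<in>I. Bernstein m (j i) (x i)) * (real (j k) / real m))
        = (\<Sum>j\<in>I \<rightarrow>\<^sub>E {..m}. \<Prod>i\<in>I. Bernstein m (j i) (x i) * (if i = k then real (j i) / real m else 1))"
      using I k by (simp add: prod.distrib prod.delta)
    also have "\<dots> = (\<Prod>i\<in>I. \<Sum>l\<le>m. Bernstein m l (x i) * (if i = k then real l / real m else 1))"
      using I by (subst prod_sum_PiE) auto
    also have "\<dots> = (\<Prod>i\<in>I. if i = k then x i else 1)"
      by (intro prod.cong refl) (simp add: mean del: times_divide_eq_right)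
    finally show ?thesis using I k by simp
  qed
  show ?thesis
    unfolding sum_distrib_left by (subst sum.swap) (simp add: marginal del: times_divide_eq_right)
qed

text \<open>Jensen's inequality for the tensor weights, whose barycentre was just computed.\<close>
lemma convex_le_tensor_Bernstein:
  assumes I: "finite I" and m: "m > 0" and x: "\<And>i. i \<in> I \<Longrightarrow> x i \<in> {0..1}"
    and f: "convex_on {0..} f"
  shows "f (\<Sum>i\<in>I. x i)
      \<le> (\<Sum>j\<in>I \<rightarrow>\<^sub>E {..m}. (\<Prod>i\<in>I. Bernstein m (j i) (x i)) * f (\<Sum>i\<in>I. real (j i) / real m))"
proof -
  have "f (\<Sum>j\<in>I \<rightarrow>\<^sub>E {..m}. (\<Prod>i\<in>I. Bernstein m (j i) (x i)) *\<^sub>R (\<Sum>i\<in>I. real (j i) / real m))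
      \<le> (\<Sum>j\<in>I \<rightarrow>\<^sub>E {..m}. (\<Prod>i\<in>I. Bernstein m (j i) (x i)) * f (\<Sum>i\<in>I. real (j i) / real m))"
  proof (rule convex_on_sum [OF _ _ f])
    show "finite (I \<rightarrow>\<^sub>E {..m})" using I by (intro finite_PiE) auto
    show "(I \<rightarrow>\<^sub>E {..m}) \<noteq> {}" by (auto simp: PiE_eq_empty_iff)
    show "(\<Sum>j\<in>I \<rightarrow>\<^sub>E {..m}. \<Prod>i\<in>I. Bernstein m (j i) (x i)) = 1"
      by (rule sum_tensor_Bernstein [OF I])
    show "0 \<le> (\<Prod>i\<in>I. Bernstein m (j i) (x i))" for j
      using x by (intro prod_nonneg) (auto intro: Bernstein_nonneg)
    show "(\<Sum>i\<in>I. real (j i) / real m) \<in> {0..}" for j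
      by (auto intro: sum_nonneg)
  qed
  then show ?thesis
    using sum_tensor_Bernstein_mean [OF I m, of x] by simp
qed

section \<open>Independent variables\<close>

lemma borel_measurable_Bernstein [measurable]: "Bernstein m k \<in> borel_measurable borel"
  unfolding Bernstein_def by measurable

lemma (in prob_space) integrable_Bernstein:
  assumes Y: "Y \<in> borel_measurable M" and AE: "AE \<omega> in M. 0 \<le> Y \<omega> \<and> Y \<omega> \<le> 1"
  shows "integrable M (\<lambda>\<omega>. Bernstein m k (Y \<omega>))"
proof (rule integrable_const_bound [where B = "real (m choose k)"])
  show "AE \<omega> in M. norm (Bernstein m k (Y \<omega>)) \<le> real (m choose k)"
    using AE
  proof eventually_elim
    case (elim \<omega>)
    have "Y \<omega> ^ k * (1 - Y \<omega>) ^ (m - k) \<le> 1 * 1"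
      using elim by (intro mult_mono power_le_one zero_le_power) auto
    then have "real (m choose k) * (Y \<omega> ^ k * (1 - Y \<omega>) ^ (m - k)) \<le> real (m choose k) * 1"
      by (intro mult_left_mono) auto
    then show ?case
      using elim Bernstein_nonneg [of "Y \<omega>" m k] by (simp add: Bernstein_def mult.assoc)
  qed
  show "(\<lambda>\<omega>. Bernstein m k (Y \<omega>)) \<in> borel_measurable M"
    using Y by measurable
qed

lemma (in prob_space)
  fixes g :: "'i \<Rightarrow> real \<Rightarrow> real"
  assumes I: "finite I" and indep: "indep_vars (\<lambda>_. borel) X I"
    and g: "\<And>i. i \<in> I \<Longrightarrow> g i \<in> borel_measurable borel"
    and int: "\<And>i. i \<in> I \<Longrightarrow> integrable M (\<lambda>\<omega>. g i (X i \<omega>))"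
  shows expectation_prod_of_indep: "expectation (\<lambda>\<omega>. \<Prod>i\<in>I. g i (X i \<omega>)) = (\<Prod>i\<in>I. expectation (\<lambda>\<omega>. g i (X i \<omega>)))"
    and integrable_prod_of_indep: "integrable M (\<lambda>\<omega>. \<Prod>i\<in>I. g i (X i \<omega>))"
proof -
  have indep': "indep_vars (\<lambda>_. borel) (\<lambda>i \<omega>. g i (X i \<omega>)) I"
    by (rule indep_vars_compose2 [OF indep g])
  show "expectation (\<lambda>\<omega>. \<Prod>i\<in>I. g i (X i \<omega>)) = (\<Prod>i\<in>I. expectation (\<lambda>\<omega>. g i (X i \<omega>)))"
    by (rule indep_vars_lebesgue_integral [OF I indep' int])
  show "integrable M (\<lambda>\<omega>. \<Prod>i\<in>I. g i (X i \<omega>))"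
    by (rule indep_vars_integrable [OF I indep' int])
qed

text \<open>
  On the event that all \<open>Z i\<close> lie on the grid, \<open>h (\<Sum>i\<in>I. Z i)\<close> is the finite sum over grid points
  of values of \<open>h\<close> times indicators, and the indicator of a grid point is a product over \<open>I\<close>.
\<close>
lemma (in prob_space)
  fixes Z :: "'i \<Rightarrow> 'a \<Rightarrow> real" and v :: "'k \<Rightarrow> real"
  assumes I: "finite I" and indep: "indep_vars (\<lambda>_. borel) Z I"
    and K: "finite K" "inj_on v K"
    and grid: "\<And>i. i \<in> I \<Longrightarrow> AE \<omega> in M. Z i \<omega> \<in> v ` K"
    and h: "h \<in> borel_measurable borel"
  shows expectation_sum_of_grid_variables:
      "expectation (\<lambda>\<omega>. h (\<Sum>i\<in>I. Z i \<omega>))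
         = (\<Sum>j\<in>I \<rightarrow>\<^sub>E K. (\<Prod>i\<in>I. prob {\<omega> \<in> space M. Z i \<omega> = v (j i)}) * h (\<Sum>i\<in>I. v (j i)))"
    and integrable_sum_of_grid_variables:
      "integrable M (\<lambda>\<omega>. h (\<Sum>i\<in>I. Z i \<omega>) :: real)"
proof -
  let ?at = "\<lambda>j \<omega>. \<Prod>i\<in>I. indicat_real {v (j i)} (Z i \<omega>)"
  let ?S = "\<lambda>\<omega>. \<Sum>j\<in>I \<rightarrow>\<^sub>E K. ?at j \<omega> * h (\<Sum>i\<in>I. v (j i))"
  have Z: "Z i \<in> borel_measurable M" if "i \<in> I" for i
    using indep that by (auto simp: indep_vars_def)
  have int1: "integrable M (\<lambda>\<omega>. indicat_real {c} (Z i \<omega>))" if "i \<in> I" for i c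
    using Z [OF that] by (intro integrable_const_bound [where B = 1]) (auto simp: indicator_def)
  have E1: "expectation (\<lambda>\<omega>. indicat_real {c} (Z i \<omega>)) = prob {\<omega> \<in> space M. Z i \<omega> = c}" if "i \<in> I" for i c
  proof -
    have "{\<omega> \<in> space M. Z i \<omega> = c} \<in> events"
      using Z [OF that] by measurable
    moreover have "expectation (\<lambda>\<omega>. indicat_real {c} (Z i \<omega>)) = expectation (indicat_real {\<omega> \<in> space M. Z i \<omega> = c})"
      by (intro Bochner_Integration.integral_cong) (auto simp: indicator_def)
    ultimately show ?thesis by simp
  qed
  have int: "integrable M (?at j)" for j
    using int1 by (intro integrable_prod_of_indep [OF I indep]) auto
  have E: "expectation (?at j) = (\<Prod>i\<in>I. prob {\<omega> \<in> space M. Z i \<omega> = v (j i)})" for j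
    using int1 by (subst expectation_prod_of_indep [OF I indep]) (auto simp: E1)
  have "AE \<omega> in M. \<forall>i\<in>I. Z i \<omega> \<in> v ` K"
    using I grid by (intro AE_finite_allI)
  then have eq: "AE \<omega> in M. h (\<Sum>i\<in>I. Z i \<omega>) = ?S \<omega>"
  proof eventually_elim
    case (elim \<omega>)
    define k where "k = restrict (\<lambda>i. inv_into K v (Z i \<omega>)) I"
    have vk: "v (k i) = Z i \<omega>" if "i \<in> I" for i
      using elim that by (auto simp: k_def f_inv_into_f)
    have kK: "k \<in> I \<rightarrow>\<^sub>E K"
      using elim by (auto simp: k_def inv_into_into)
    have "?at j \<omega> = (if j = k then 1 else 0)" if j: "j \<in> I \<rightarrow>\<^sub>E K" for j
    proof (cases "j = k")
      case True
      then show ?thesis by (auto simp: vk)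
    next
      case False
      then obtain i where i: "i \<in> I" "j i \<noteq> k i"
        using PiE_ext [OF j kK] by blast
      then have "v (j i) \<noteq> v (k i)"
        using K(2) j kK by (auto simp: inj_on_def PiE_mem)
      then have "indicat_real {v (j i)} (Z i \<omega>) = 0"
        using i vk by (auto simp: indicator_def)
      then show ?thesis using False I i by (auto intro!: prod_zero)
    qed
    then have "?S \<omega> = (\<Sum>j\<in>I \<rightarrow>\<^sub>E K. if j = k then h (\<Sum>i\<in>I. v (j i)) else 0)"
      by (intro sum.cong) auto
    also have "\<dots> = h (\<Sum>i\<in>I. v (k i))"
      using I K kK by (simp add: finite_PiE)
    also have "\<dots> = h (\<Sum>i\<in>I. Z i \<omega>)" by (simp add: vk)
    finally show ?case by simp
  qed
  have hm: "(\<lambda>\<omega>. h (\<Sum>i\<in>I. Z i \<omega>)) \<in> borel_measurable M"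
    using Z h by measurable
  have intS: "integrable M ?S"
    using int by (intro Bochner_Integration.integrable_sum integrable_mult_left) auto
  have "expectation (\<lambda>\<omega>. h (\<Sum>i\<in>I. Z i \<omega>)) = expectation ?S"
    using hm intS eq by (intro integral_cong_AE) auto
  also have "\<dots> = (\<Sum>j\<in>I \<rightarrow>\<^sub>E K. (\<Prod>i\<in>I. prob {\<omega> \<in> space M. Z i \<omega> = v (j i)}) * h (\<Sum>i\<in>I. v (j i)))"
    using int by (subst Bochner_Integration.integral_sum) (auto simp: E)
  finally show "expectation (\<lambda>\<omega>. h (\<Sum>i\<in>I. Z i \<omega>))
    = (\<Sum>j\<in>I \<rightarrow>\<^sub>E K. (\<Prod>i\<in>I. prob {\<omega> \<in> space M. Z i \<omega> = v (j i)}) * h (\<Sum>i\<in>I. v (j i)))" .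
  have eq': "AE \<omega> in M. ?S \<omega> = h (\<Sum>i\<in>I. Z i \<omega>)"
    using eq by eventually_elim simp
  show "integrable M (\<lambda>\<omega>. h (\<Sum>i\<in>I. Z i \<omega>))"
    using intS hm eq' by (rule integrable_cong_AE_imp)
qed

section \<open>Convex functions on the half-line\<close>

text \<open>
  Continuity may fail at \<open>0\<close>, and extensionality fixes a single value on the negative reals, so
  \<open>f\<close> is pieced together from \<open>(0,\<infinity>)\<close>, the endpoint and the negative half-line.
\<close>
lemma borel_measurable_convex_half_line:
  fixes f :: "real \<Rightarrow> real"
  assumes "f \<in> extensional {0..}" "convex_on {0..} f"
  shows "f \<in> borel_measurable borel"
proof -
  have "convex_on {0<..} f"
    by (rule convex_on_subset [OF assms(2)]) auto
  then have "continuous_on {0<..} f"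
    by (intro convex_on_continuous) auto
  then have [measurable]: "(\<lambda>x. indicator {0<..} x *\<^sub>R f x) \<in> borel_measurable borel"
    by (intro borel_measurable_continuous_on_indicator) auto
  have "(\<lambda>x. indicator {0<..} x *\<^sub>R f x + indicator {0} x *\<^sub>R f 0 + indicator {..<0} x *\<^sub>R undefined)
      \<in> borel_measurable borel"
    by measurable
  also have "(\<lambda>x. indicator {0<..} x *\<^sub>R f x + indicator {0} x *\<^sub>R f 0 + indicator {..<0} x *\<^sub>R undefined) = f"
    using assms(1) by (auto simp: fun_eq_iff extensional_def indicator_def)
  finally show ?thesis .
qed

text \<open>
  At \<open>t > 0\<close> the right derivative serves as slope; it is nonnegative because \<open>f\<close> increases to
  the right of \<open>t\<close>.  The endpoint \<open>t = 0\<close> is not interior, but there monotonicity alone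
  makes the horizontal line a supporting line.
\<close>
lemma supporting_line_nonneg_slope:
  fixes f :: "real \<Rightarrow> real"
  assumes f: "convex_on {0..} f" and mono: "mono_on {t..} f" and t: "t \<ge> 0"
  obtains c where "c \<ge> 0" "\<And>x. x \<ge> 0 \<Longrightarrow> f x \<ge> f t + c * (x - t)"
proof (cases "t = 0")
  case True
  have "f x \<ge> f t + 0 * (x - t)" if "x \<ge> 0" for x
    using mono_onD [OF mono, of t x] that True by simp
  then show ?thesis by (rule that [of 0, OF order_refl])
next
  case False
  let ?D = "(\<lambda>y. (f t - f y) / (t - y)) ` ({t<..} \<inter> {0..})"
  have "t \<in> interior {0..}" using False t by (simp add: interior_real_atLeast)
  from convex_le_Inf_differential [OF f this]
  have line: "f x \<ge> f t + Inf ?D * (x - t)" if "x \<ge> 0" for x using that by simp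
  have "0 \<le> Inf ?D"
  proof (rule cInf_greatest)
    have "t + 1 \<in> {t<..} \<inter> {0..}" using t by auto
    then show "?D \<noteq> {}" by blast
  next
    fix d assume "d \<in> ?D"
    then obtain y where y: "d = (f t - f y) / (t - y)" "t < y" by auto
    moreover have "f t \<le> f y" using mono_onD [OF mono, of t y] y(2) by simp
    ultimately show "0 \<le> d" by (auto intro: divide_nonpos_neg)
  qed
  then show ?thesis using line by (rule that)
qed

text \<open>
  The class \<open>F_ic t\<close> consists of extensional functions, hence the restriction; it leaves expectations
  of almost surely nonnegative variables unchanged.
\<close>
definition hinge :: "real \<Rightarrow> real \<Rightarrow> real" where
  "hinge a = restrict (\<lambda>x. max 0 (x - a)) {0..}"

lemma hinge_in_F_ic: "hinge a \<in> F_ic t" if "t \<ge> 0"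
proof -
  have "convex_on {0..} (\<lambda>x. max 0 (x - a))"
  proof (rule convex_onI)
    fix s x y :: real
    assume s: "0 < s" "s < 1"
    have "(1 - s) * (x - a) \<le> (1 - s) * max 0 (x - a)" "s * (y - a) \<le> s * max 0 (y - a)"
      "0 \<le> (1 - s) * max 0 (x - a)" "0 \<le> s * max 0 (y - a)"
      using s by (auto intro!: mult_left_mono mult_nonneg_nonneg)
    moreover have "(1 - s) * (x - a) + s * (y - a) = ((1 - s) *\<^sub>R x + s *\<^sub>R y) - a"
      by (simp add: algebra_simps)
    ultimately show "max 0 (((1 - s) *\<^sub>R x + s *\<^sub>R y) - a) \<le> (1 - s) * max 0 (x - a) + s * max 0 (y - a)"
      by (intro max.boundedI) linarith+
  qed simp
  then have "convex_on {0..} (hinge a)"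
    unfolding convex_on_def hinge_def by simp
  then show ?thesis
    using that by (auto simp: F_ic_def hinge_def mono_on_def)
qed

section \<open>The two parts of the bound\<close>

text \<open>
  Markov's inequality, applied to the tensor Bernstein majorant of \<open>f (\<Sum>i\<in>I. X i)\<close>.  The majorant is a
  finite combination of products of functions of the single \<open>X i\<close>, so its expectation factorises.
\<close>
lemma (in prob_space) prob_sum_ge_le_tensor_Bernstein:
  assumes I: "finite I" and m: "m > 0"
    and indep: "indep_vars (\<lambda>_. borel) X I"
    and X: "\<And>i. i \<in> I \<Longrightarrow> AE \<omega> in M. 0 \<le> X i \<omega> \<and> X i \<omega> \<le> 1"
    and f: "f \<in> F_ic t" "f t > 0"
  shows "prob {\<omega> \<in> space M. (\<Sum>i\<in>I. X i \<omega>) \<ge> t}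
      \<le> 1 / f t * (\<Sum>j\<in>I \<rightarrow>\<^sub>E {..m}. (\<Prod>i\<in>I. expectation (\<lambda>\<omega>. Bernstein m (j i) (X i \<omega>)))
                                          * f (\<Sum>i\<in>I. real (j i) / real m))"
proof -
  let ?A = "{\<omega> \<in> space M. (\<Sum>i\<in>I. X i \<omega>) \<ge> t}"
  let ?w = "\<lambda>j \<omega>. \<Prod>i\<in>I. Bernstein m (j i) (X i \<omega>)"
  let ?S = "\<lambda>\<omega>. \<Sum>j\<in>I \<rightarrow>\<^sub>E {..m}. ?w j \<omega> * f (\<Sum>i\<in>I. real (j i) / real m)"
  have conv: "convex_on {0..} f" and mono: "mono_on {t..} f" and nonneg: "\<And>x. x \<ge> 0 \<Longrightarrow> f x \<ge> 0"
    using f(1) by (auto simp: F_ic_def)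
  have Xm: "X i \<in> borel_measurable M" if "i \<in> I" for i
    using indep that by (auto simp: indep_vars_def)
  have int1: "integrable M (\<lambda>\<omega>. Bernstein m k (X i \<omega>))" if "i \<in> I" for i k
    using integrable_Bernstein Xm X that by blast
  have int: "integrable M (?w j)" for j
    using int1 by (intro integrable_prod_of_indep [OF I indep]) auto
  have E: "expectation (?w j) = (\<Prod>i\<in>I. expectation (\<lambda>\<omega>. Bernstein m (j i) (X i \<omega>)))" for j
    using int1 by (intro expectation_prod_of_indep [OF I indep]) auto
  have intS: "integrable M ?S"
    using int by (intro Bochner_Integration.integrable_sum integrable_mult_left) auto
  have A: "?A \<in> events"
    using Xm by measurable
  have "AE \<omega> in M. \<forall>i\<in>I. 0 \<le> X i \<omega> \<and> X i \<omega> \<le> 1"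
    using I X by (intro AE_finite_allI)
  then have le: "AE \<omega> in M. indicat_real ?A \<omega> \<le> 1 / f t * ?S \<omega>"
  proof eventually_elim
    case (elim \<omega>)
    have S0: "(\<Sum>i\<in>I. X i \<omega>) \<ge> 0" using elim by (auto intro: sum_nonneg)
    have fS: "f (\<Sum>i\<in>I. X i \<omega>) \<le> ?S \<omega>"
      using elim by (intro convex_le_tensor_Bernstein [OF I m _ conv]) auto
    have "indicat_real ?A \<omega> * f t \<le> f (\<Sum>i\<in>I. X i \<omega>)"
      using mono_onD [OF mono, of t "\<Sum>i\<in>I. X i \<omega>"] nonneg [OF S0] by (auto simp: indicator_def)
    with fS have "indicat_real ?A \<omega> * f t \<le> ?S \<omega>" by linarith
    then show ?case using f(2) by (simp add: pos_le_divide_eq)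
  qed
  have intA: "integrable M (indicat_real ?A)"
    using A by (intro integrable_const_bound [where B = 1]) auto
  have "prob ?A = expectation (indicat_real ?A)" using A by simp
  also have "\<dots> \<le> expectation (\<lambda>\<omega>. 1 / f t * ?S \<omega>)"
    using intA intS le by (intro integral_mono_AE integrable_mult_right)
  also have "\<dots> = 1 / f t * expectation ?S" by simp
  also have "expectation ?S = (\<Sum>j\<in>I \<rightarrow>\<^sub>E {..m}. expectation (?w j) * f (\<Sum>i\<in>I. real (j i) / real m))"
    using int by (subst Bochner_Integration.integral_sum) auto
  finally show ?thesis by (simp only: E)
qed

text \<open>
  Every competitor dominates, after normalisation at \<open>t\<close>, either a hinge or the constant \<open>1\<close>, according
  to whether its supporting line at \<open>t\<close> is increasing or horizontal.  For \<open>a < 0\<close> the normalised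
  hinge expectation equals \<open>1 + (E S - t) / (t - a)\<close>, so the constant is approached as \<open>a\<close> tends
  to \<open>-\<infinity>\<close>, and the infimum over hinges need not be attained.
\<close>
lemma (in prob_space) INF_F_ic_eq_INF_hinge:
  assumes t: "t \<ge> 0" and S: "integrable M S" and S0: "AE \<omega> in M. S \<omega> \<ge> 0"
    and int: "\<And>f. f \<in> F_ic t \<Longrightarrow> integrable M (\<lambda>\<omega>. f (S \<omega>))"
  shows "(INF f\<in>{f \<in> F_ic t. f t > 0}. 1 / f t * expectation (\<lambda>\<omega>. f (S \<omega>)))
       = (INF a\<in>{..<t}. 1 / (t - a) * expectation (\<lambda>\<omega>. max 0 (S \<omega> - a)))"
    (is "Inf (?L ` ?F) = Inf (?R ` _)")
proof (rule antisym)
  have intR: "integrable M (\<lambda>\<omega>. max 0 (S \<omega> - a))" for a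
    using S by (intro integrable_max) auto
  have bddF: "bdd_below (?L ` ?F)"
  proof (rule bdd_belowI2 [where m = 0])
    fix f assume f: "f \<in> ?F"
    have "AE \<omega> in M. 0 \<le> f (S \<omega>)"
      using S0 by eventually_elim (use f in \<open>auto simp: F_ic_def\<close>)
    then show "0 \<le> ?L f" using f by (auto intro!: divide_nonneg_pos integral_nonneg_AE)
  qed
  have bddR: "bdd_below (?R ` {..<t})"
    by (rule bdd_belowI2 [where m = 0]) auto
  have hinge_t: "hinge a t = t - a" if "a < t" for a
    using that t by (simp add: hinge_def)
  have hinge_F: "hinge a \<in> ?F" if "a < t" for a
    using that t hinge_in_F_ic by (simp add: hinge_t)
  have hinge_R: "?L (hinge a) = ?R a" if a: "a < t" for a
  proof -
    have "expectation (\<lambda>\<omega>. hinge a (S \<omega>)) = expectation (\<lambda>\<omega>. max 0 (S \<omega> - a))"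
    proof (rule integral_cong_AE)
      show "AE \<omega> in M. hinge a (S \<omega>) = max 0 (S \<omega> - a)"
        using S0 by eventually_elim (simp add: hinge_def)
    qed (use int [OF hinge_in_F_ic [OF t]] intR in \<open>auto\<close>)
    then show ?thesis using a by (simp add: hinge_t)
  qed
  show "Inf (?L ` ?F) \<le> Inf (?R ` {..<t})"
  proof (rule cINF_greatest)
    fix a assume "a \<in> {..<t}"
    then show "Inf (?L ` ?F) \<le> ?R a"
      using cINF_lower [OF bddF hinge_F, of a] hinge_R [of a] by simp
  qed (use lt_ex in auto)
  show "Inf (?R ` {..<t}) \<le> Inf (?L ` ?F)"
  proof (rule cINF_greatest)
    have "hinge (t - 1) \<in> ?F" by (rule hinge_F) simp
    then show "?F \<noteq> {}" by blast
  next
    fix f assume f: "f \<in> ?F"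
    then have conv: "convex_on {0..} f" and mono: "mono_on {t..} f" and nonneg: "\<And>x. x \<ge> 0 \<Longrightarrow> f x \<ge> 0"
      and ft: "f t > 0" and intf: "integrable M (\<lambda>\<omega>. f (S \<omega>))"
      using int by (auto simp: F_ic_def)
    obtain c where c: "c \<ge> 0" and line: "\<And>x. x \<ge> 0 \<Longrightarrow> f x \<ge> f t + c * (x - t)"
      using supporting_line_nonneg_slope [OF conv mono t] by blast
    show "Inf (?R ` {..<t}) \<le> ?L f"
    proof (cases "c = 0")
      case False
      with c have c: "c > 0" by simp
      \<comment> \<open>The zero of the supporting line.\<close>
      define a where "a = t - f t / c"
      have a: "a < t" and ta: "1 / (t - a) = c / f t"
        using c ft by (auto simp: a_def)
      have "AE \<omega> in M. c * max 0 (S \<omega> - a) \<le> f (S \<omega>)"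
        using S0
      proof eventually_elim
        case (elim \<omega>)
        have "c * (S \<omega> - a) = f t + c * (S \<omega> - t)"
          using c by (simp add: a_def field_simps)
        then show ?case using line [OF elim] nonneg [OF elim] by (simp add: max_def)
      qed
      then have "expectation (\<lambda>\<omega>. c * max 0 (S \<omega> - a)) \<le> expectation (\<lambda>\<omega>. f (S \<omega>))"
        using intR intf by (intro integral_mono_AE integrable_mult_right)
      then have "?R a \<le> ?L f"
        unfolding ta using ft by (simp add: divide_right_mono)
      then show ?thesis using cINF_lower [OF bddR, of a] a by simp
    next
      case True
      have "AE \<omega> in M. f t \<le> f (S \<omega>)"
        using S0 by eventually_elim (use line True in auto)
      then have "expectation (\<lambda>\<omega>. f t) \<le> expectation (\<lambda>\<omega>. f (S \<omega>))"
        using intf by (intro integral_mono_AE) auto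
      then have "1 \<le> ?L f" using ft by (simp add: prob_space)
      moreover have "Inf (?R ` {..<t}) \<le> 1"
      proof (rule tendsto_lowerbound)
        have far: "filterlim (\<lambda>a. t - a) at_top at_bot"
          using filterlim_tendsto_add_at_top [OF tendsto_const filterlim_uminus_at_top_at_bot, of t] by simp
        have "((\<lambda>a. 1 + (expectation S - t) / (t - a)) \<longlongrightarrow> 1 + 0) at_bot"
          by (intro tendsto_add tendsto_const tendsto_divide_0 [OF tendsto_const]
              filterlim_at_top_imp_at_infinity far)
        then show "((\<lambda>a. 1 + (expectation S - t) / (t - a)) \<longlongrightarrow> 1) at_bot" by simp
        show "\<forall>\<^sub>F a in at_bot. Inf (?R ` {..<t}) \<le> 1 + (expectation S - t) / (t - a)"
          using eventually_gt_at_bot [of "min 0 t"]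
        proof eventually_elim
          case (elim a)
          \<comment> \<open>For negative \<open>a\<close> the hinge is affine on the range of \<open>S\<close>.\<close>
          have "AE \<omega> in M. max 0 (S \<omega> - a) = S \<omega> - a"
            using S0 by eventually_elim (use elim in auto)
          then have "expectation (\<lambda>\<omega>. max 0 (S \<omega> - a)) = expectation (\<lambda>\<omega>. S \<omega> - a)"
            using intR S by (intro integral_cong_AE) auto
          also have "\<dots> = expectation S - a" using S by (simp add: prob_space)
          finally have "?R a = 1 + (expectation S - t) / (t - a)"
            using elim by (simp add: field_simps)
          then show ?case using cINF_lower [OF bddR, of a] elim by simp
        qed
      qed simp
      ultimately show ?thesis by linarith
    qed
  qed
qed

theorem theorem4p3:
  fixes n m :: nat
    and \<mu> :: "nat \<Rightarrow> nat \<Rightarrow> real"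
    and M :: "'a measure" and X :: "nat \<Rightarrow> 'a \<Rightarrow> real"
    and N :: "'b measure" and Z :: "nat \<Rightarrow> 'b \<Rightarrow> real"
    and t :: real
  assumes "n \<ge> 2" and "m \<ge> 2"
    and "\<And>i. i \<in> {1..n} \<Longrightarrow> \<mu> i 1 < 1"
    and "\<And>i. i \<in> {1..n} \<Longrightarrow> antimono_on {1..m} (\<mu> i)"
    and "\<And>i. i \<in> {1..n} \<Longrightarrow> \<mu> i m > 0"
    and "\<And>i. i \<in> {1..n} \<Longrightarrow> moment_class M m (\<mu> i) \<noteq> {}"
    and "prob_space M"
    and "prob_space.indep_vars M (\<lambda>_. borel) X {1..n}"
    and "\<And>i. i \<in> {1..n} \<Longrightarrow> X i \<in> moment_class M m (\<mu> i)"
    and "t \<in> {0..real n}"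
    and "prob_space N"
    and "prob_space.indep_vars N (\<lambda>_. borel) Z {1..n}"
    and "\<And>i j. i \<in> {1..n} \<Longrightarrow> j \<in> {0..m} \<Longrightarrow>
           measure N {\<omega> \<in> space N. Z i \<omega> = real j / real m} =
             real (m choose j) * integral\<^sup>L M (\<lambda>\<omega>. X i \<omega> ^ j * (1 - X i \<omega>) ^ (m - j))"
  shows "measure M {\<omega> \<in> space M. (\<Sum>i=1..n. X i \<omega>) \<ge> t}
           \<le> (INF f\<in>{f \<in> F_ic t. f t > 0}.
                1 / f t * integral\<^sup>L N (\<lambda>\<omega>. f (\<Sum>i=1..n. Z i \<omega>)))
       \<and> (INF f\<in>{f \<in> F_ic t. f t > 0}.
                1 / f t * integral\<^sup>L N (\<lambda>\<omega>. f (\<Sum>i=1..n. Z i \<omega>)))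
           = (INF a\<in>{..<t}.
                1 / (t - a) * integral\<^sup>L N (\<lambda>\<omega>. max 0 ((\<Sum>i=1..n. Z i \<omega>) - a)))"
proof -
  interpret M: prob_space M by fact
  interpret N: prob_space N by fact
  let ?I = "{1..n}" and ?v = "\<lambda>j. real j / real m"
  let ?S = "\<lambda>\<omega>. \<Sum>i=1..n. Z i \<omega>"
  let ?L = "\<lambda>f. 1 / f t * integral\<^sup>L N (\<lambda>\<omega>. f (?S \<omega>))"
  let ?F = "{f \<in> F_ic t. f t > 0}"
  have m: "m > 0" and t: "t \<ge> 0" using assms(2,10) by auto
  have inj: "inj_on ?v {..m}" using m by (auto simp: inj_on_def)
  have X: "X i \<in> borel_measurable M" "AE \<omega> in M. 0 \<le> X i \<omega> \<and> X i \<omega> \<le> 1" if "i \<in> ?I" for i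
    using assms(9) [OF that] by (auto simp: moment_class_def)
  have Zm: "Z i \<in> borel_measurable N" if "i \<in> ?I" for i
    using assms(12) that by (auto simp: N.indep_vars_def)
  have Z: "measure N {\<omega> \<in> space N. Z i \<omega> = ?v j} = M.expectation (\<lambda>\<omega>. Bernstein m j (X i \<omega>))"
    if "i \<in> ?I" "j \<le> m" for i j
    using assms(13) [of i j] that by (simp add: Bernstein_def mult.assoc)
  have intB: "integrable M (\<lambda>\<omega>. Bernstein m j (X i \<omega>))" if "i \<in> ?I" for i j
    using X [OF that] by (rule M.integrable_Bernstein)
  \<comment> \<open>The point masses at the grid points add up to \<open>1\<close> because Bernstein polynomials do.\<close>
  have grid: "AE \<omega> in N. Z i \<omega> \<in> ?v ` {..m}" if i: "i \<in> ?I" for i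
  proof -
    have events: "{\<omega> \<in> space N. Z i \<omega> = c} \<in> N.events" for c
      using Zm [OF i] by measurable
    have "N.prob {\<omega> \<in> space N. Z i \<omega> \<in> ?v ` {..m}} = N.prob (\<Union>j\<le>m. {\<omega> \<in> space N. Z i \<omega> = ?v j})"
      by (intro arg_cong [where f = N.prob]) auto
    also have "\<dots> = (\<Sum>j\<le>m. N.prob {\<omega> \<in> space N. Z i \<omega> = ?v j})"
      using events m by (intro N.finite_measure_finite_Union) (auto simp: disjoint_family_on_def)
    also have "\<dots> = (\<Sum>j\<le>m. M.expectation (\<lambda>\<omega>. Bernstein m j (X i \<omega>)))"
      using Z i by (intro sum.cong) auto
    also have "\<dots> = M.expectation (\<lambda>\<omega>. \<Sum>j\<le>m. Bernstein m j (X i \<omega>))"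
      using intB [OF i] by (subst Bochner_Integration.integral_sum) auto
    also have "\<dots> = 1" by (simp add: M.prob_space)
    finally have "N.prob {\<omega> \<in> space N. Z i \<omega> \<in> ?v ` {..m}} = 1" .
    moreover have "{\<omega> \<in> space N. Z i \<omega> \<in> ?v ` {..m}} \<in> N.events"
      by (rule measurable_sets_Collect [OF Zm [OF i]]) (auto intro: borel_closed finite_imp_closed)
    ultimately show ?thesis by (simp add: N.prob_Collect_eq_1)
  qed
  note grid_facts = assms(12) finite_atMost inj grid
  have f_measurable: "f \<in> borel_measurable borel" if "f \<in> F_ic t" for f
    using that by (intro borel_measurable_convex_half_line) (auto simp: F_ic_def PiE_def)
  have "measure M {\<omega> \<in> space M. (\<Sum>i=1..n. X i \<omega>) \<ge> t} \<le> (INF f\<in>?F. ?L f)"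
  proof (rule cINF_greatest)
    have "hinge (t - 1) \<in> ?F"
      using t hinge_in_F_ic [OF t] by (simp add: hinge_def)
    then show "?F \<noteq> {}" by blast
  next
    fix f assume f: "f \<in> ?F"
    have "integral\<^sup>L N (\<lambda>\<omega>. f (?S \<omega>))
        = (\<Sum>j\<in>?I \<rightarrow>\<^sub>E {..m}. (\<Prod>i\<in>?I. N.prob {\<omega> \<in> space N. Z i \<omega> = ?v (j i)}) * f (\<Sum>i\<in>?I. ?v (j i)))"
      using f f_measurable by (intro N.expectation_sum_of_grid_variables [OF _ grid_facts]) auto
    also have "\<dots> = (\<Sum>j\<in>?I \<rightarrow>\<^sub>E {..m}. (\<Prod>i\<in>?I. M.expectation (\<lambda>\<omega>. Bernstein m (j i) (X i \<omega>)))
                                             * f (\<Sum>i\<in>?I. ?v (j i)))"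
      by (intro sum.cong prod.cong refl arg_cong2 [where f = "(*)"] Z) (auto simp: PiE_iff)
    finally show "measure M {\<omega> \<in> space M. (\<Sum>i=1..n. X i \<omega>) \<ge> t} \<le> ?L f"
      using M.prob_sum_ge_le_tensor_Bernstein [OF _ m assms(8) X(2), of f t] f by simp
  qed
  moreover have "(INF f\<in>?F. ?L f)
      = (INF a\<in>{..<t}. 1 / (t - a) * integral\<^sup>L N (\<lambda>\<omega>. max 0 (?S \<omega> - a)))"
  proof (rule N.INF_F_ic_eq_INF_hinge [OF t])
    show "integrable N ?S"
      using N.integrable_sum_of_grid_variables [OF _ grid_facts, of "\<lambda>x. x"] by simp
    have "AE \<omega> in N. \<forall>i\<in>?I. Z i \<omega> \<in> ?v ` {..m}"
      using grid by (intro AE_finite_allI) auto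
    then show "AE \<omega> in N. ?S \<omega> \<ge> 0"
    proof eventually_elim
      case (elim \<omega>)
      have "Z i \<omega> \<ge> 0" if "i \<in> ?I" for i
      proof -
        have "Z i \<omega> \<in> ?v ` {..m}" using elim that by blast
        then show ?thesis by auto
      qed
      then show ?case by (rule sum_nonneg)
    qed
    show "integrable N (\<lambda>\<omega>. f (?S \<omega>))" if "f \<in> F_ic t" for f
      using that f_measurable by (intro N.integrable_sum_of_grid_variables [OF _ grid_facts]) auto
  qed
  ultimately show ?thesis by blast
qed

end
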